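(* Let $T$ be any labelled tree on $n<5$ vertices $1,\dots,n$, and let $A\in M_n(\mathbb{R})$ be T-TP. Then the smallest eigenvalue of $A$ (the eigenvalue of minimum modulus) is real, and it has an eigenvector $v$ that is totally nonzero (all entries nonzero) and signed according to $T$, i.e. $v_iv_j<0$ for every edge $\{i,j\}$ of $T$.
   Context: A real matrix is totally positive (TP) if every minor of it is positive. For $A\in M_n(\mathbb{R})$ and an ordered list $\alpha$ of distinct indices, $A[\alpha]$ denotes the principal submatrix with rows and columns indexed by $\alpha$, taken in the order of $\alpha$. For a labelled tree $T$ on vertices $1,\dots,n$ and a path $P$ in $T$, $A[P]$ denotes $A[\alpha]$ where $\alpha$ lists the vertices of $P$ in the order in which they occur along $P$ (the choice of direction is immaterial). $A$ is called T-TP if $A[P]$ is TP for every path $P$ of $T$. A vector $v\in\mathbb{R}^n$ is signed according to $T$ if $v_iv_j<0$ whenever $\{i,j\}$ is an edge of $T$. The "smallest eigenvalue" refers to the eigenvalue of $A$ of smallest absolute value. *)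

theory Defs
  imports
    "Jordan_Normal_Form.Spectral_Radius"
    "Jordan_Normal_Form.DL_Submatrix"
    "Graph_Theory.Graph_Theory"
begin

text \<open>
  Vertices, matrix rows and matrix columns are all indexed by \<open>0, \<dots>, n - 1\<close>, as is usual
  for \<^typ>\<open>'a mat\<close>; index \<open>i\<close> stands for the label \<open>i + 1\<close>.

  Finite simple undirected graphs are the irreflexive symmetric digraphs of
  \<^locale>\<open>pair_graph\<close>: an edge \<open>{i, j}\<close> is the pair of arcs \<open>(i, j)\<close>, \<open>(j, i)\<close>.
\<close>

text \<open>
  \<^const>\<open>tree\<close> cannot be used for such graphs: for \<^const>\<open>pre_digraph.cycle\<close> the closed walk
  \<open>i, j, i\<close> along a single edge is a cycle. The cycles of the undirected graph are those
  of length at least 3. A tree has at least one vertex, since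
  \<^const>\<open>Digraph_Component.connected\<close> excludes the empty graph.
\<close>

definition undirected_tree :: "'a pair_pre_digraph \<Rightarrow> bool" where
  "undirected_tree T \<longleftrightarrow>
     pair_graph T \<and>
     Digraph_Component.connected (with_proj T) \<and>
     \<not> (\<exists>p. pre_digraph.cycle (with_proj T) p \<and> length p \<ge> 3)"

definition totally_positive :: "real mat \<Rightarrow> bool" where
  "totally_positive A \<longleftrightarrow>
     (\<forall>I J. I \<subseteq> {..<dim_row A} \<longrightarrow> J \<subseteq> {..<dim_col A} \<longrightarrow> I \<noteq> {} \<longrightarrow> card I = card J \<longrightarrow>
        det (submatrix A I J) > 0)"

definition principal_submatrix_list :: "'a mat \<Rightarrow> nat list \<Rightarrow> 'a mat" where
  "principal_submatrix_list A \<alpha> =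
     mat (length \<alpha>) (length \<alpha>) (\<lambda>(i, j). A $$ (\<alpha> ! i, \<alpha> ! j))"

text \<open>
  \<^const>\<open>vpath\<close> describes a path by the list of its (distinct) vertices; both directions
  of a path occur, and a single vertex counts as a path.
\<close>

definition T_TP :: "nat pair_pre_digraph \<Rightarrow> real mat \<Rightarrow> bool" where
  "T_TP T A \<longleftrightarrow>
     (\<forall>p. vpath p (with_proj T) \<longrightarrow> totally_positive (principal_submatrix_list A p))"

definition signed_according_to :: "nat pair_pre_digraph \<Rightarrow> real vec \<Rightarrow> bool" where
  "signed_according_to T v \<longleftrightarrow> (\<forall>i j. (i, j) \<in> parcs T \<longrightarrow> v $ i * v $ j < 0)"

text \<open>The eigenvalues of a real matrix are its complex ones.\<close>

definition min_modulus_eigenvalue :: "real mat \<Rightarrow> complex \<Rightarrow> bool" where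
  "min_modulus_eigenvalue A \<mu> \<longleftrightarrow>
     eigenvalue (map_mat complex_of_real A) \<mu> \<and>
     (\<forall>\<nu>. eigenvalue (map_mat complex_of_real A) \<nu> \<longrightarrow> cmod \<mu> \<le> cmod \<nu>)"

end

theory Submission
  imports Defs
begin

text \<open>
  If \<open>S adj(A) S\<close> is entrywise positive for a diagonal sign matrix \<open>S\<close>, then the Perron vector
  \<open>x\<close> and Perron root \<open>\<rho>\<close> of \<open>S adj(A) S\<close> make \<open>S x\<close> an eigenvector of \<open>A\<close> for \<open>det A / \<rho>\<close>,
  and this is strictly the smallest eigenvalue in modulus; \<open>A\<close> may be singular. It remains to
  find the signs of \<open>adj(A)\<close>. Consider a longest path of the tree: on fewer than five vertices
  it is Hamiltonian, or else the tree is the star on four vertices. In the first case \<open>A\<close> is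
  totally positive up to relabelling, so \<open>adj(A)\<close> has the checkerboard pattern. For the star,
  the Schur complement of the centre has negative off-diagonal entries, positive diagonal and
  positive principal \<open>2 \<times> 2\<close> minors, so its adjugate is positive; this gives the signs of
  \<open>adj(A)\<close> at the pendant vertices, and the equations \<open>A adj(A) = adj(A) A = det A \<cdot> 1\<close> give
  the remaining ones.
\<close>

section \<open>Perron's theorem for positive matrices\<close>

text \<open>An index minimising \<open>f i / g i\<close> works: this quotient gives the largest
  multiple of \<open>g\<close> below \<open>f\<close>, touching \<open>f\<close> at
  \<open>m\<close>. It yields Collatz-Wielandt quotients below and, applied to negated moduli, the
  least multiple of a positive vector above the moduli of another vector.\<close>

lemma exists_min_ratio:
  fixes f g :: "nat \<Rightarrow> real"
  assumes n: "n > 0" and g: "\<And>i. i < n \<Longrightarrow> g i > 0"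
  obtains m where "m < n" "\<And>i. i < n \<Longrightarrow> f i \<ge> f m / g m * g i"
proof -
  let ?S = "(\<lambda>i. f i / g i) ` {..<n}"
  have "Min ?S \<in> ?S" using n by (intro Min_in) auto
  then obtain m where m: "m < n" "f m / g m = Min ?S" by auto
  have "f i \<ge> f m / g m * g i" if "i < n" for i
  proof -
    have "f m / g m \<le> f i / g i" using that m(2) by simp
    with g[OF that] show ?thesis by (simp add: pos_le_divide_eq)
  qed
  with m(1) show thesis by (rule that)
qed

lemma mult_mat_vec_index_sum:
  assumes "A \<in> carrier_mat n n" "v \<in> carrier_vec n" "i < n"
  shows "(A *\<^sub>v v) $ i = (\<Sum>j<n. A $$ (i,j) * v $ j)"
  using assms by (auto simp: scalar_prod_def lessThan_atLeast0 intro!: sum.cong)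

lemma eigenvector_iff_sum:
  assumes "A \<in> carrier_mat n n" "v \<in> carrier_vec n"
  shows "eigenvector A v k \<longleftrightarrow>
    (\<exists>i<n. v $ i \<noteq> 0) \<and> (\<forall>i<n. (\<Sum>j<n. A $$ (i,j) * v $ j) = k * v $ i)"
proof -
  have "v \<noteq> 0\<^sub>v n \<longleftrightarrow> (\<exists>i<n. v $ i \<noteq> 0)" using assms by auto
  moreover have "A *\<^sub>v v = k \<cdot>\<^sub>v v \<longleftrightarrow> (\<forall>i<n. (A *\<^sub>v v) $ i = (k \<cdot>\<^sub>v v) $ i)"
    using assms by (auto simp: vec_eq_iff simp del: index_mult_mat_vec)
  ultimately show ?thesis
    using assms by (auto simp: eigenvector_def mult_mat_vec_index_sum simp del: index_mult_mat_vec)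
qed

text \<open>If \<open>P y \<ge> s y\<close> with \<open>s\<close> above the spectral radius, then the powers of \<open>t\<inverse> P\<close>,
  for \<open>t\<close> in between, are bounded but expand \<open>y\<close>.\<close>

lemma spectral_radius_ge_subinvariance:
  fixes P :: "real mat"
  assumes P: "P \<in> carrier_mat n n" and nonneg: "\<And>i j. i < n \<Longrightarrow> j < n \<Longrightarrow> P $$ (i,j) \<ge> 0"
    and n: "n > 0" and y: "\<And>i. i < n \<Longrightarrow> y i > 0"
    and sub: "\<And>i. i < n \<Longrightarrow> (\<Sum>j<n. P $$ (i,j) * y j) \<ge> s * y i"
  shows "s \<le> spectral_radius (map_mat complex_of_real P)"
proof (rule ccontr)
  let ?PC = "map_mat complex_of_real P"
  define r where "r = spectral_radius ?PC"
  assume "\<not> s \<le> spectral_radius (map_mat complex_of_real P)"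
  hence rs: "r < s" by (simp add: r_def)
  have PC: "?PC \<in> carrier_mat n n" using P by simp
  have "r \<ge> 0" using spectral_radius_mem_max(1)[OF PC n] unfolding r_def by auto
  define t where "t = (r + s) / 2"
  have t: "t > 0" "r < t" "t < s" using rs \<open>r \<ge> 0\<close> by (auto simp: t_def)
  define Q where "Q = (1 / t) \<cdot>\<^sub>m P"
  let ?QC = "map_mat complex_of_real Q"
  have Q: "Q \<in> carrier_mat n n" "?QC \<in> carrier_mat n n" using P by (auto simp: Q_def)
  have nonnegQ: "Q $$ (i,j) \<ge> 0" if "i < n" "j < n" for i j
    using nonneg[OF that] that P t by (simp add: Q_def)
  have "spectral_radius ?QC < 1"
  proof -
    obtain \<nu> where \<nu>: "eigenvalue ?QC \<nu>" "spectral_radius ?QC = cmod \<nu>"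
      using spectral_radius_mem_max(1)[OF Q(2) n] by (auto simp: spectrum_def)
    then obtain v where v: "eigenvector ?QC v \<nu>" by (auto simp: eigenvalue_def)
    have vc: "v \<in> carrier_vec n" using v Q by (auto simp: eigenvector_def)
    have "eigenvector ?PC v (t * \<nu>)"
      unfolding eigenvector_iff_sum[OF PC vc]
    proof (intro conjI allI impI)
      show "\<exists>i<n. v $ i \<noteq> 0" using v eigenvector_iff_sum[OF Q(2) vc] by auto
      fix i assume i: "i < n"
      have "(\<Sum>j<n. ?PC $$ (i,j) * v $ j) = of_real t * (\<Sum>j<n. ?QC $$ (i,j) * v $ j)"
        unfolding sum_distrib_left using i P t by (intro sum.cong) (auto simp: Q_def)
      also have "\<dots> = of_real t * (\<nu> * v $ i)"
        using v eigenvector_iff_sum[OF Q(2) vc] i by auto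
      finally show "(\<Sum>j<n. ?PC $$ (i,j) * v $ j) = of_real t * \<nu> * v $ i" by simp
    qed
    hence "cmod (of_real t * \<nu>) \<le> r" unfolding r_def
      by (intro spectral_radius_mem_max(2)[OF PC n] imageI) (auto simp: spectrum_def eigenvalue_def)
    hence "t * cmod \<nu> \<le> r" using t by (simp add: norm_mult)
    hence "t * cmod \<nu> < t * 1" using t by linarith
    with t(1) \<nu>(2) show ?thesis by (simp only: mult_less_cancel_left_pos)
  qed
  then obtain c where c: "\<And>k. norm_bound (?QC ^\<^sub>m k) c"
    using spectral_radius_jnf_norm_bound_less_1_upper_triangular[OF Q(2)] by blast
  have Qk: "Q ^\<^sub>m k \<in> carrier_mat n n" for k using Q by simp
  have QkC: "?QC ^\<^sub>m k = map_mat complex_of_real (Q ^\<^sub>m k)" for k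
    by (rule of_real_hom.mat_hom_pow[OF Q(1), symmetric])
  have bound: "(Q ^\<^sub>m k) $$ (i,j) \<le> c" if "i < n" "j < n" for i j k
  proof -
    have "cmod ((?QC ^\<^sub>m k) $$ (i,j)) \<le> c" using c[of k] that Q by (simp add: norm_bound_def)
    thus ?thesis unfolding QkC using that carrier_matD[OF Qk] by (auto simp: abs_le_iff)
  qed
  define yv where "yv = vec n y"
  have yv: "yv \<in> carrier_vec n" by (simp add: yv_def)
  define q where "q = s / t"
  have q: "q > 1" using t by (simp add: q_def)
  have grow: "(Q ^\<^sub>m k *\<^sub>v yv) $ i \<ge> q ^ k * y i" if "i < n" for i k
    using that
  proof (induction k arbitrary: i)
    case 0
    thus ?case using Q yv by (simp add: yv_def)
  next
    case (Suc k)
    \<comment> \<open>Powers of matrices grow on the right, whereas the induction has to apply the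
      nonnegative \<open>Q\<close> from the left.\<close>
    have "Q ^\<^sub>m Suc k = Q * Q ^\<^sub>m k"
      by (induction k) (use Q(1) Qk assoc_mult_mat[OF Q(1) Qk Q(1)] in simp_all)
    hence eq: "Q ^\<^sub>m Suc k *\<^sub>v yv = Q *\<^sub>v (Q ^\<^sub>m k *\<^sub>v yv)"
      using assoc_mult_mat_vec[OF Q(1) Qk yv, of k] by simp
    have "q ^ Suc k * y i = q ^ k * (1 / t * (s * y i))" by (simp add: q_def)
    also have "\<dots> \<le> q ^ k * (1 / t * (\<Sum>j<n. P $$ (i,j) * y j))"
      using sub[OF Suc.prems] t q by (intro mult_left_mono) auto
    also have "\<dots> = (\<Sum>j<n. Q $$ (i,j) * (q ^ k * y j))"
      unfolding sum_distrib_left using P Suc.prems by (intro sum.cong) (auto simp: Q_def)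
    also have "\<dots> \<le> (\<Sum>j<n. Q $$ (i,j) * (Q ^\<^sub>m k *\<^sub>v yv) $ j)"
      using Suc by (intro sum_mono mult_left_mono nonnegQ) auto
    also have "\<dots> = (Q ^\<^sub>m Suc k *\<^sub>v yv) $ i"
      unfolding eq by (rule mult_mat_vec_index_sum[symmetric, OF Q(1) _ Suc.prems])
        (rule mult_mat_vec_carrier[OF Qk yv])
    finally show ?case .
  qed
  \<comment> \<open>Row 0 alone gives the contradiction: its entries are at most \<open>c\<close> in
    every power, so \<open>q ^ k\<close> would be bounded although \<open>q > 1\<close>.\<close>
  have "q ^ k \<le> (\<Sum>j<n. c * y j) / y 0" for k
  proof -
    have "q ^ k * y 0 \<le> (Q ^\<^sub>m k *\<^sub>v yv) $ 0" by (rule grow[OF n])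
    also have "\<dots> = (\<Sum>j<n. (Q ^\<^sub>m k) $$ (0,j) * yv $ j)"
      by (rule mult_mat_vec_index_sum[OF Qk yv n])
    also have "\<dots> \<le> (\<Sum>j<n. c * y j)"
      using bound[OF n] y by (intro sum_mono) (auto simp: yv_def intro!: mult_right_mono less_imp_le)
    finally show ?thesis using y[OF n] by (simp add: pos_le_divide_eq)
  qed
  moreover obtain k where "(\<Sum>j<n. c * y j) / y 0 < q ^ k" using real_arch_pow[OF q] by blast
  ultimately show False by (meson not_less)
qed

text \<open>Let \<open>u\<close> consist of the moduli of an eigenvector for an eigenvalue of
  maximal modulus \<rho>. The triangle inequality gives \<open>P u\<close> \<ge> \<rho>
  \<open>u\<close>. If this were strict anywhere, one more application of \<open>P\<close> would
  make it strict everywhere, and \<open>y = P u\<close> would be expanded by a factor above the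
  spectral radius.\<close>

lemma perron_eigenvector_exists:
  fixes P :: "real mat"
  assumes P: "P \<in> carrier_mat n n" and pos: "\<And>i j. i < n \<Longrightarrow> j < n \<Longrightarrow> P $$ (i,j) > 0"
    and n: "n > 0"
  obtains \<rho> x where "\<rho> > 0" "\<And>i. i < n \<Longrightarrow> x i > 0"
    "\<And>i. i < n \<Longrightarrow> (\<Sum>j<n. P $$ (i,j) * x j) = \<rho> * x i"
proof -
  let ?PC = "map_mat complex_of_real P"
  have PC: "?PC \<in> carrier_mat n n" using P by simp
  define \<rho> where "\<rho> = spectral_radius ?PC"
  obtain \<nu> where \<nu>: "eigenvalue ?PC \<nu>" "\<rho> = cmod \<nu>"
    using spectral_radius_mem_max(1)[OF PC n] by (auto simp: spectrum_def \<rho>_def)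
  then obtain v where v: "eigenvector ?PC v \<nu>" by (auto simp: eigenvalue_def)
  have vc: "v \<in> carrier_vec n" using v P by (auto simp: eigenvector_def)
  define u where "u i = cmod (v $ i)" for i
  define y where "y i = (\<Sum>j<n. P $$ (i,j) * u j)" for i
  obtain m where m: "m < n" "v $ m \<noteq> 0" using v eigenvector_iff_sum[OF PC vc] by auto
  have ypos: "y i > 0" if "i < n" for i
    unfolding y_def using m pos[OF that]
    by (intro sum_pos2[of _ m]) (auto simp: u_def less_imp_le)
  have yge: "y i \<ge> \<rho> * u i" if i: "i < n" for i
  proof -
    have "\<rho> * u i = cmod (\<Sum>j<n. ?PC $$ (i,j) * v $ j)"
      using v eigenvector_iff_sum[OF PC vc] i by (auto simp: \<nu>(2) u_def norm_mult)
    also have "\<dots> \<le> (\<Sum>j<n. cmod (?PC $$ (i,j) * v $ j))" by (rule norm_sum)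
    also have "\<dots> = y i" unfolding y_def using P pos i
      by (intro sum.cong) (auto simp: norm_mult u_def less_imp_le)
    finally show ?thesis .
  qed
  have yeq: "y i = \<rho> * u i" if i: "i < n" for i
  proof (rule ccontr)
    assume ne: "y i \<noteq> \<rho> * u i"
    define z where "z k = (\<Sum>j<n. P $$ (k,j) * y j)" for k
    have zgt: "z k > \<rho> * y k" if k: "k < n" for k
    proof -
      \<comment> \<open>Every entry of \<open>P\<close> is positive, so the single strict inequality
        at \<open>i\<close> spreads to every row \<open>k\<close>.\<close>
      have "0 < (\<Sum>j<n. P $$ (k,j) * (y j - \<rho> * u j))"
        using i ne pos[OF k] yge
        by (intro sum_pos2[of _ i]) (auto simp: less_imp_le order_le_neq_trans)
      also have "\<dots> = z k - \<rho> * y k"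
        unfolding z_def y_def[of k] sum_distrib_left sum_subtractf[symmetric]
        by (intro sum.cong) (auto simp: algebra_simps)
      finally show ?thesis by simp
    qed
    \<comment> \<open>The least quotient \<open>z k / y k\<close> is an expansion factor valid in
      all rows, hence at most \<rho>, against \<open>zgt\<close> at the same
      \<open>k\<close>.\<close>
    obtain k where k: "k < n" "\<And>i. i < n \<Longrightarrow> z i \<ge> z k / y k * y i"
      using exists_min_ratio[of n y z, OF n ypos] by blast
    have "z k / y k \<le> \<rho>" unfolding \<rho>_def
      using k(2) pos by (intro spectral_radius_ge_subinvariance[OF P _ n ypos])
        (auto simp: z_def less_imp_le)
    with zgt[OF k(1)] ypos[OF k(1)] show False by (simp add: pos_divide_le_eq)
  qed
  have "\<rho> \<ge> 0" by (simp add: \<nu>(2))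
  moreover have "\<rho> \<noteq> 0" using ypos[OF n] yeq[OF n] by auto
  ultimately have \<rho>: "\<rho> > 0" by simp
  show thesis
  proof (rule that[OF \<rho>])
    fix i assume i: "i < n"
    show "u i > 0" using ypos[OF i] yeq[OF i] \<rho> by (simp add: zero_less_mult_iff)
    show "(\<Sum>j<n. P $$ (i,j) * u j) = \<rho> * u i" using yeq[OF i] by (simp add: y_def)
  qed
qed

text \<open>Scale \<open>x\<close> until it touches the moduli of \<open>w\<close> from above at
  some index \<open>i\<close>; row \<open>i\<close> of the two eigenvalue equations then compares
  \<nu> with \<rho>. The equality case is what later singles out one eigenvalue of minimum
  modulus.\<close>

lemma perron_dominates:
  fixes w :: "nat \<Rightarrow> complex" and P :: "nat \<Rightarrow> nat \<Rightarrow> real"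
  assumes pos: "\<And>i j. i < n \<Longrightarrow> j < n \<Longrightarrow> P i j > 0"
    and x: "\<And>i. i < n \<Longrightarrow> x i > 0" "\<And>i. i < n \<Longrightarrow> (\<Sum>j<n. P i j * x j) = \<rho> * x i"
    and w: "m < n" "w m \<noteq> 0" "\<And>i. i < n \<Longrightarrow> (\<Sum>j<n. complex_of_real (P i j) * w j) = \<nu> * w i"
  shows "cmod \<nu> \<le> \<rho>" and "cmod \<nu> = \<rho> \<Longrightarrow> \<nu> = of_real \<rho>"
proof -
  obtain i where i: "i < n" "\<And>j. j < n \<Longrightarrow> - cmod (w j) \<ge> - cmod (w i) / x i * x j"
    using exists_min_ratio[of n x "\<lambda>j. - cmod (w j)"] w(1) x(1) by auto
  define M where "M = cmod (w i) / x i"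
  have bd: "cmod (w j) \<le> M * x j" if "j < n" for j using i(2)[OF that] by (simp add: M_def)
  have wi: "cmod (w i) = M * x i" using x(1)[OF i(1)] by (simp add: M_def)
  \<comment> \<open>The nonzero entry of \<open>w\<close> at \<open>m\<close> forces the scaling
    factor \<open>M\<close> to be positive.\<close>
  have "M * x m > 0" using bd[OF w(1)] w(2) by (meson less_le_trans zero_less_norm_iff)
  hence M: "M > 0" using x(1)[OF w(1)] by (simp add: zero_less_mult_iff)
  text \<open>Rotate \<open>w\<close> so that \<open>\<nu> w\<^sub>i\<close> becomes a nonnegative real.\<close>
  obtain c where c: "cmod c = 1" "c * (\<nu> * w i) = of_real (cmod (\<nu> * w i))"
  proof (cases "\<nu> * w i = 0")
    case True
    thus ?thesis by (intro that[of 1]) auto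
  next
    case False
    show ?thesis
    proof (rule that)
      show "cmod (cnj (sgn (\<nu> * w i))) = 1" using False by (simp add: norm_sgn)
      show "cnj (sgn (\<nu> * w i)) * (\<nu> * w i) = of_real (cmod (\<nu> * w i))"
        using False complex_norm_square[of "\<nu> * w i"]
        by (simp add: sgn_div_norm scaleR_conv_of_real field_simps power2_eq_square)
    qed
  qed
  have bd': "Re (c * w j) \<le> M * x j" if "j < n" for j
    using bd[OF that] complex_Re_le_cmod[of "c * w j"] c(1) by (simp add: norm_mult)
  have eq: "cmod \<nu> * (M * x i) = (\<Sum>j<n. P i j * Re (c * w j))"
  proof -
    have "cmod \<nu> * (M * x i) = Re (c * (\<nu> * w i))" unfolding c(2) by (simp add: norm_mult wi)
    also have "\<dots> = Re (\<Sum>j<n. of_real (P i j) * (c * w j))"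
      unfolding w(3)[OF i(1), symmetric] sum_distrib_left by (simp add: mult.left_commute)
    finally show ?thesis by (simp add: Re_sum)
  qed
  have eqx: "(\<Sum>j<n. P i j * (M * x j)) = \<rho> * (M * x i)"
    using x(2)[OF i(1)] by (simp add: mult.left_commute[of _ M] sum_distrib_left[symmetric])
  have Mx: "M * x i > 0" using M x(1)[OF i(1)] by simp
  have "cmod \<nu> * (M * x i) \<le> \<rho> * (M * x i)"
    unfolding eq eqx[symmetric] using bd' pos[OF i(1)]
    by (intro sum_mono mult_left_mono) (auto simp: less_imp_le)
  thus "cmod \<nu> \<le> \<rho>" using Mx by (simp only: mult_le_cancel_right_pos)
  assume \<nu>: "cmod \<nu> = \<rho>"
  have "(\<Sum>j<n. P i j * (M * x j - Re (c * w j))) = 0"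
    using eq eqx \<nu> by (simp add: right_diff_distrib sum_subtractf)
  \<comment> \<open>A vanishing sum of nonnegative terms has only zero terms. The diagonal term
    already shows that the rotated entry at \<open>i\<close> has real part equal to its modulus, so
    it is a positive real.\<close>
  hence "P i i * (M * x i - Re (c * w i)) = 0"
    using sum_nonneg_eq_0_iff[of "{..<n}" "\<lambda>j. P i j * (M * x j - Re (c * w j))"]
      pos[OF i(1)] bd' i(1) by (auto simp: less_imp_le)
  hence Re: "Re (c * w i) = M * x i" using pos[OF i(1) i(1)] by simp
  have "cmod (c * w i) = M * x i" using c(1) wi by (simp add: norm_mult)
  hence "Im (c * w i) = 0" using Re cmod_power2[of "c * w i"] by simp
  hence cw: "c * w i = of_real (M * x i)" using Re by (simp add: complex_eq_iff)
  have "\<nu> * of_real (M * x i) = of_real (\<rho> * (M * x i))"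
    using c(2) unfolding cw[symmetric] by (simp add: norm_mult wi \<nu> mult.left_commute)
  thus "\<nu> = of_real \<rho>" using Mx by auto
qed

section \<open>Signed adjugates and the smallest eigenvalue\<close>

lemma smult_one_mat_mult_vec:
  fixes v :: "'a :: comm_ring_1 vec"
  assumes v: "v \<in> carrier_vec n"
  shows "(d \<cdot>\<^sub>m 1\<^sub>m n) *\<^sub>v v = d \<cdot>\<^sub>v v"
proof -
  have "(d \<cdot>\<^sub>m 1\<^sub>m n) *\<^sub>v v = d \<cdot>\<^sub>v (1\<^sub>m n *\<^sub>v v)"
    using v by (intro eq_vecI) auto
  thus ?thesis using v by simp
qed

text \<open>Here \<open>X\<close> stands for the adjugate and \<open>d\<close> for the determinant
  of \<open>A\<close>. Conjugating \<open>X\<close> by the signs gives a positive matrix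
  \<open>P\<close> with Perron root \<rho>, and \<open>r\<close> is \<open>d\<close> divided by
  \<rho>. For \<open>d\<close> nonzero, an eigenvalue \<nu> of \<open>A\<close> makes
  \<open>d\<close> / \<nu> an eigenvalue of \<open>P\<close>, so large moduli for \<open>P\<close>
  are small moduli for \<open>A\<close>.\<close>

lemma min_modulus_eigenvalue_of_signed_cofactors:
  fixes A X :: "real mat" and s :: "nat \<Rightarrow> real"
  assumes A: "A \<in> carrier_mat n n" and X: "X \<in> carrier_mat n n" and n: "n > 0"
    and AX: "A * X = d \<cdot>\<^sub>m 1\<^sub>m n" and XA: "X * A = d \<cdot>\<^sub>m 1\<^sub>m n"
    and s: "\<And>i. i < n \<Longrightarrow> \<bar>s i\<bar> = 1"
    and pos: "\<And>i j. i < n \<Longrightarrow> j < n \<Longrightarrow> s i * s j * X $$ (i,j) > 0"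
  obtains r v where "\<And>\<mu>. min_modulus_eigenvalue A \<mu> \<longleftrightarrow> \<mu> = complex_of_real r"
    "eigenvector A v r" "\<And>i. i < n \<Longrightarrow> s i * v $ i > 0"
proof -
  have ss: "s i * s i = 1" if "i < n" for i
    using s[OF that] by (metis abs_mult_self_eq mult_1)
  define P where "P = mat n n (\<lambda>(i,j). s i * s j * X $$ (i,j))"
  have P: "P \<in> carrier_mat n n" by (simp add: P_def)
  have Pij: "P $$ (i,j) = s i * s j * X $$ (i,j)" if "i < n" "j < n" for i j
    using that by (simp add: P_def)
  obtain \<rho> x where \<rho>: "\<rho> > 0" and x: "\<And>i. i < n \<Longrightarrow> x i > 0"
    "\<And>i. i < n \<Longrightarrow> (\<Sum>j<n. P $$ (i,j) * x j) = \<rho> * x i"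
  proof (rule perron_eigenvector_exists[OF P _ n])
    show "P $$ (i,j) > 0" if "i < n" "j < n" for i j using that by (simp add: Pij pos)
  qed blast
  define v where "v = vec n (\<lambda>i. s i * x i)"
  have v: "v \<in> carrier_vec n" by (simp add: v_def)
  define r where "r = d / \<rho>"
  have Xv: "X *\<^sub>v v = \<rho> \<cdot>\<^sub>v v"
  proof (rule eq_vecI)
    fix i assume "i < dim_vec (\<rho> \<cdot>\<^sub>v v)"
    hence i: "i < n" by (simp add: v_def)
    have "(X *\<^sub>v v) $ i = s i * (\<Sum>j<n. P $$ (i,j) * x j)"
      unfolding mult_mat_vec_index_sum[OF X v i] sum_distrib_left
    proof (rule sum.cong)
      fix j assume j: "j \<in> {..<n}"
      have "s i * (P $$ (i,j) * x j) = s i * s i * (X $$ (i,j) * (s j * x j))"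
        using i j by (simp add: Pij)
      thus "X $$ (i,j) * v $ j = s i * (P $$ (i,j) * x j)"
        using i j by (auto simp: ss v_def)
    qed simp
    thus "(X *\<^sub>v v) $ i = (\<rho> \<cdot>\<^sub>v v) $ i" using i by (simp add: x v_def)
  qed (use X in \<open>simp add: v_def\<close>)
  \<comment> \<open>Evaluating \<open>A X v\<close> in two ways gives \<rho>
    \<open>A v = d v\<close>, with no division by \<open>d\<close>.\<close>
  have "\<rho> \<cdot>\<^sub>v (A *\<^sub>v v) = A *\<^sub>v (X *\<^sub>v v)"
    unfolding Xv using mult_mat_vec[OF A v] by simp
  also have "\<dots> = d \<cdot>\<^sub>v v"
    using assoc_mult_mat_vec[OF A X v] AX v by (simp add: smult_one_mat_mult_vec)
  finally have "(1 / \<rho>) \<cdot>\<^sub>v (\<rho> \<cdot>\<^sub>v (A *\<^sub>v v)) = (1 / \<rho>) \<cdot>\<^sub>v (d \<cdot>\<^sub>v v)" by simp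
  hence Av: "A *\<^sub>v v = r \<cdot>\<^sub>v v" using \<rho> by (simp add: smult_smult_assoc r_def)
  have spos: "s i * v $ i > 0" if "i < n" for i
    using that x(1)[OF that] ss[OF that] by (simp add: v_def mult.assoc[symmetric])
  have ev: "eigenvector A v r"
    using Av v A spos[OF n] n by (auto simp: eigenvector_def)
  let ?AC = "map_mat complex_of_real A" and ?XC = "map_mat complex_of_real X"
  have AC: "?AC \<in> carrier_mat n n" and XC: "?XC \<in> carrier_mat n n" using A X by auto
  have "?AC *\<^sub>v map_vec of_real v = map_vec of_real (r \<cdot>\<^sub>v v)"
    unfolding Av[symmetric] by (rule of_real_hom.mult_mat_vec_hom[OF A v, symmetric])
  also have "\<dots> = of_real r \<cdot>\<^sub>v map_vec of_real v" by (simp add: of_real_hom.vec_hom_smult)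
  finally have "eigenvector ?AC (map_vec of_real v) (of_real r)"
    using v A spos[OF n] n by (auto simp: eigenvector_def vec_eq_iff)
  hence evC: "eigenvalue ?AC (of_real r)" by (auto simp: eigenvalue_def)
  have XAC: "?XC * ?AC = of_real d \<cdot>\<^sub>m 1\<^sub>m n"
    unfolding of_real_hom.mat_hom_mult[OF X A, symmetric] XA
    by (intro eq_matI) auto
  have dom: "\<bar>r\<bar> \<le> cmod \<nu> \<and> (cmod \<nu> = \<bar>r\<bar> \<longrightarrow> \<nu> = of_real r)" if \<nu>ev: "eigenvalue ?AC \<nu>" for \<nu>
  proof (cases "d = 0")
    \<comment> \<open>In the singular case \<open>r = 0\<close>, and 0 is the only number of modulus
      0.\<close>
    case True
    thus ?thesis by (simp add: r_def)
  next
    case False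
    obtain w where w: "eigenvector ?AC w \<nu>" using \<nu>ev unfolding eigenvalue_def by blast
    hence wc: "w \<in> carrier_vec n" and Aw: "?AC *\<^sub>v w = \<nu> \<cdot>\<^sub>v w"
      using A by (auto simp: eigenvector_def)
    obtain m where m: "m < n" "w $ m \<noteq> 0" using w eigenvector_iff_sum[OF AC wc] by auto
    \<comment> \<open>Applying \<open>X\<close> to \<open>A w\<close> = \<nu> \<open>w\<close> gives
      \<open>d w\<close> = \<nu> \<open>X w\<close>. As \<open>d\<close> and some entry of
      \<open>w\<close> are nonzero, so is \<nu>, and \<open>w\<close> is an eigenvector of
      \<open>X\<close> for \<open>d\<close> / \<nu>.\<close>
    have XCw: "of_real d \<cdot>\<^sub>v w = \<nu> \<cdot>\<^sub>v (?XC *\<^sub>v w)"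
    proof -
      have "of_real d \<cdot>\<^sub>v w = (?XC * ?AC) *\<^sub>v w" using wc by (simp add: XAC smult_one_mat_mult_vec)
      also have "\<dots> = ?XC *\<^sub>v (\<nu> \<cdot>\<^sub>v w)" using assoc_mult_mat_vec[OF XC AC wc] Aw by simp
      finally show ?thesis using mult_mat_vec[OF XC wc] by simp
    qed
    have dw: "of_real d * w $ i = \<nu> * (\<Sum>j<n. of_real (X $$ (i,j)) * w $ j)" if "i < n" for i
    proof -
      have "(of_real d \<cdot>\<^sub>v w) $ i = (\<nu> \<cdot>\<^sub>v (?XC *\<^sub>v w)) $ i" by (simp only: XCw)
      thus ?thesis using that wc X mult_mat_vec_index_sum[OF XC wc that]
        by (simp del: index_mult_mat_vec)
    qed
    have \<nu>: "\<nu> \<noteq> 0" using dw[OF m(1)] m(2) False by auto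
    \<comment> \<open>The signs square to 1, so multiplying \<open>w\<close> entrywise by
      \<open>s\<close> turns an eigenvector of \<open>X\<close> into one of
      \<open>P\<close>.\<close>
    have Pw: "(\<Sum>j<n. of_real (P $$ (i,j)) * (of_real (s j) * w $ j))
        = of_real d / \<nu> * (of_real (s i) * w $ i)" if i: "i < n" for i
    proof -
      have "(\<Sum>j<n. of_real (P $$ (i,j)) * (of_real (s j) * w $ j))
          = of_real (s i) * (\<Sum>j<n. of_real (X $$ (i,j)) * w $ j)"
        unfolding sum_distrib_left
      proof (rule sum.cong)
        fix j assume j: "j \<in> {..<n}"
        have "complex_of_real (P $$ (i,j)) * (of_real (s j) * w $ j)
            = of_real (s j * s j) * (of_real (s i) * (of_real (X $$ (i,j)) * w $ j))"
          using i j by (simp add: Pij)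
        thus "complex_of_real (P $$ (i,j)) * (of_real (s j) * w $ j)
            = of_real (s i) * (of_real (X $$ (i,j)) * w $ j)"
          using j ss[of j] by (simp del: of_real_mult)
      qed simp
      thus ?thesis using dw[OF i] \<nu> by (simp add: field_simps)
    qed
    have sm: "of_real (s m) * w $ m \<noteq> 0" using m s[OF m(1)] by auto
    have posP: "P $$ (i,j) > 0" if "i < n" "j < n" for i j using that by (simp add: Pij pos)
    note D = perron_dominates[where P = "\<lambda>i j. P $$ (i,j)" and
        w = "\<lambda>j. of_real (s j) * w $ j", OF posP x m(1) sm Pw]
    have nz: "cmod \<nu> > 0" using \<nu> by simp
    have "\<bar>d\<bar> / cmod \<nu> \<le> \<rho>" using D(1) by (simp add: norm_divide)
    hence "\<bar>r\<bar> \<le> cmod \<nu>" using nz \<rho> by (simp add: r_def field_simps)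
    moreover have "\<nu> = of_real r" if eq: "cmod \<nu> = \<bar>r\<bar>"
    proof -
      have "cmod (of_real d / \<nu>) = \<rho>" using eq nz \<rho> False by (simp add: norm_divide r_def)
      hence "of_real d / \<nu> = of_real \<rho>" using D(2) by blast
      thus ?thesis using \<nu> \<rho> by (simp add: r_def field_simps)
    qed
    ultimately show ?thesis by blast
  qed
  show thesis
  proof (rule that[OF _ ev spos])
    fix \<mu> show "min_modulus_eigenvalue A \<mu> \<longleftrightarrow> \<mu> = complex_of_real r"
    proof
      assume "min_modulus_eigenvalue A \<mu>"
      hence \<mu>: "eigenvalue ?AC \<mu>" "cmod \<mu> \<le> \<bar>r\<bar>"
        using evC unfolding min_modulus_eigenvalue_def by (auto dest: spec[of _ "of_real r"])
      thus "\<mu> = complex_of_real r" using dom[OF \<mu>(1)] by auto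
    next
      assume \<mu>: "\<mu> = complex_of_real r"
      show "min_modulus_eigenvalue A \<mu>"
        unfolding min_modulus_eigenvalue_def \<mu> norm_of_real using evC dom by blast
    qed
  qed
qed

section \<open>Relabelling: simultaneous permutations of rows and columns\<close>

lemma principal_submatrix_list_carrier [simp]:
  "principal_submatrix_list A p \<in> carrier_mat (length p) (length p)"
  by (simp add: principal_submatrix_list_def)

lemma principal_submatrix_list_index [simp]:
  "i < length p \<Longrightarrow> j < length p \<Longrightarrow> principal_submatrix_list A p $$ (i,j) = A $$ (p ! i, p ! j)"
  by (simp add: principal_submatrix_list_def)

lemma principal_submatrix_list_dim [simp]:
  "dim_row (principal_submatrix_list A p) = length p"
  "dim_col (principal_submatrix_list A p) = length p"
  by (simp_all add: principal_submatrix_list_def)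

text \<open>For a list of all indices, taking the submatrix is conjugation by a permutation matrix,
  hence multiplicative: the inner sum is reindexed along \<open>p\<close>. This transports the
  defining identities of the adjugate.\<close>

lemma principal_submatrix_list_mult:
  assumes A: "A \<in> carrier_mat n n" and B: "B \<in> carrier_mat n n"
    and p: "distinct p" "set p = {..<n}"
  shows "principal_submatrix_list (A * B) p = principal_submatrix_list A p * principal_submatrix_list B p"
proof (rule eq_matI)
  have len: "length p = n" using p distinct_card[OF p(1)] by simp
  have mem: "p ! i < n" if "i < n" for i using that p(2) len nth_mem[of i p] by auto
  have bij: "bij_betw ((!) p) {..<n} {..<n}" using bij_betw_nth[OF p(1)] p(2) len by simp
  fix i j assume "i < dim_row (principal_submatrix_list A p * principal_submatrix_list B p)"
    "j < dim_col (principal_submatrix_list A p * principal_submatrix_list B p)"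
  hence ij: "i < n" "j < n" by (simp_all add: len)
  have "(A * B) $$ (p ! i, p ! j) = (\<Sum>k<n. A $$ (p ! i, k) * B $$ (k, p ! j))"
    using A B ij mem by (auto simp: scalar_prod_def lessThan_atLeast0 intro!: sum.cong)
  also have "\<dots> = (\<Sum>k<n. A $$ (p ! i, p ! k) * B $$ (p ! k, p ! j))"
    by (rule sum.reindex_bij_betw[OF bij, symmetric])
  also have "\<dots> = (principal_submatrix_list A p * principal_submatrix_list B p) $$ (i,j)"
    using ij len by (auto simp: scalar_prod_def lessThan_atLeast0 intro!: sum.cong)
  finally show "principal_submatrix_list (A * B) p $$ (i,j)
      = (principal_submatrix_list A p * principal_submatrix_list B p) $$ (i,j)"
    using ij len by simp
qed (simp_all)

lemma principal_submatrix_list_smult_one: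
  assumes p: "distinct p" "set p = {..<n}"
  shows "principal_submatrix_list (d \<cdot>\<^sub>m 1\<^sub>m n) p = d \<cdot>\<^sub>m 1\<^sub>m n"
proof -
  have len: "length p = n" using p distinct_card[OF p(1)] by simp
  have mem: "p ! i < n" if "i < n" for i using that p(2) len nth_mem[of i p] by auto
  show ?thesis using mem p(1) len
    by (intro eq_matI) (auto simp: nth_eq_iff_index_eq)
qed

text \<open>The sign pattern is known in the order of \<open>p\<close>, not in the order of the
  labels. The adjugate of the permuted matrix is permuted back and used as \<open>X\<close>; only
  the two product identities have to be carried over.\<close>

lemma min_modulus_eigenvalue_of_signed_adj_mat:
  fixes A :: "real mat" and s :: "nat \<Rightarrow> real"
  assumes A: "A \<in> carrier_mat n n" and n: "n > 0"
    and p: "distinct p" "set p = {..<n}"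
    and s: "\<And>i. i < n \<Longrightarrow> \<bar>s i\<bar> = 1"
    and pos: "\<And>i j. i < n \<Longrightarrow> j < n \<Longrightarrow>
      s i * s j * adj_mat (principal_submatrix_list A p) $$ (i,j) > 0"
  obtains r v where "\<And>\<mu>. min_modulus_eigenvalue A \<mu> \<longleftrightarrow> \<mu> = complex_of_real r"
    "eigenvector A v r" "\<And>i. i < n \<Longrightarrow> s i * v $ (p ! i) > 0"
proof -
  have len: "length p = n" using p distinct_card[OF p(1)] by simp
  have mem: "p ! i < n" if "i < n" for i using that p(2) len nth_mem[of i p] by auto
  have bij: "bij_betw ((!) p) {..<n} {..<n}" using bij_betw_nth[OF p(1)] p(2) len by simp
  define f where "f = inv_into {..<n} ((!) p)"
  have bijf: "bij_betw f {..<n} {..<n}" unfolding f_def by (rule bij_betw_inv_into[OF bij])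
  have f: "f i < n" "p ! f i = i" if "i < n" for i
    using that bij_betwE[OF bijf] bij_betw_inv_into_right[OF bij] by (auto simp: f_def)
  have fp: "f (p ! i) = i" if "i < n" for i
    using that bij_betw_inv_into_left[OF bij] by (simp add: f_def)
  \<comment> \<open>\<open>q\<close> lists the inverse permutation, so permuting by \<open>p\<close>
    and then by \<open>q\<close> restores \<open>A\<close>.\<close>
  define q where "q = map f [0..<n]"
  have q: "distinct q" "set q = {..<n}" "length q = n"
    using bijf by (auto simp: q_def distinct_map bij_betw_def lessThan_atLeast0)
  let ?B = "principal_submatrix_list A p"
  let ?X = "principal_submatrix_list (adj_mat ?B) q"
  have B: "?B \<in> carrier_mat n n" using len principal_submatrix_list_carrier[of A p] by simp
  have BA: "principal_submatrix_list ?B q = A"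
    using A f len q(3) by (intro eq_matI) (auto simp: q_def)
  note adj = adj_mat[OF B]
  have AX: "A * ?X = det ?B \<cdot>\<^sub>m 1\<^sub>m n" and XA: "?X * A = det ?B \<cdot>\<^sub>m 1\<^sub>m n"
    using principal_submatrix_list_mult[OF B adj(1) q(1,2)]
      principal_submatrix_list_mult[OF adj(1) B q(1,2)]
      principal_submatrix_list_smult_one[OF q(1,2), of "det ?B"] by (simp_all add: BA adj)
  have X: "?X \<in> carrier_mat n n" using q(3) principal_submatrix_list_carrier[of _ q] by simp
  obtain r v where rv: "\<And>\<mu>. min_modulus_eigenvalue A \<mu> \<longleftrightarrow> \<mu> = complex_of_real r"
    "eigenvector A v r" "\<And>i. i < n \<Longrightarrow> s (f i) * v $ i > 0"
  proof (rule min_modulus_eigenvalue_of_signed_cofactors[OF A X n AX XA])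
    show "\<bar>s (f i)\<bar> = 1" if "i < n" for i using s f(1)[OF that] by blast
    show "s (f i) * s (f j) * ?X $$ (i,j) > 0" if "i < n" "j < n" for i j
      using pos[OF f(1)[OF that(1)] f(1)[OF that(2)]] that q(3) by (simp add: q_def)
  qed blast
  show thesis
    
  proof (rule that[OF rv(1,2)])
    show "s i * v $ (p ! i) > 0" if "i < n" for i using rv(3)[OF mem[OF that]] fp[OF that] by simp
  qed
qed

section \<open>Minors of totally positive matrices\<close>

lemma submatrix_eq_mat:
  assumes "I \<subseteq> {..<dim_row A}" "J \<subseteq> {..<dim_col A}"
  shows "submatrix A I J = mat (card I) (card J) (\<lambda>(i,j). A $$ (pick I i, pick J j))"
proof -
  have "{i. i < dim_row A \<and> i \<in> I} = I" "{j. j < dim_col A \<and> j \<in> J} = J"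
    using assms by auto
  thus ?thesis by (simp add: submatrix_def)
qed

text \<open>An element of a set is picked at the position given by the number of smaller elements.
  The resulting shift past \<open>i\<close> is that of \<open>mat_delete\<close>, which identifies
  minors omitting one row and one column with those in cofactors.\<close>

lemma pick_complement_singleton:
  assumes "i < n" "k < n - 1"
  shows "pick ({..<n} - {i}) k = (if k < i then k else Suc k)"
proof -
  let ?k = "if k < i then k else Suc k"
  have "{a \<in> {..<n} - {i}. a < ?k} = (if k < i then {..<k} else {..k} - {i})"
    using assms by auto
  hence card: "card {a \<in> {..<n} - {i}. a < ?k} = k" by auto
  have "?k \<in> {..<n} - {i}" using assms by auto
  from pick_card_in_set[OF this] show ?thesis by (simp only: card)
qed

lemma submatrix_complement_singleton:
  assumes "A \<in> carrier_mat n n" "i < n" "j < n"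
  shows "submatrix A ({..<n} - {i}) ({..<n} - {j}) = mat_delete A i j"
proof (rule eq_matI)
  have dim: "card ({..<n} - {i}) = n - 1" "card ({..<n} - {j}) = n - 1" using assms by auto
  have eq: "submatrix A ({..<n} - {i}) ({..<n} - {j}) = mat (n - 1) (n - 1)
      (\<lambda>(k,l). A $$ (pick ({..<n} - {i}) k, pick ({..<n} - {j}) l))"
    using assms by (subst submatrix_eq_mat) (auto simp only: dim carrier_matD)
  show "dim_row (submatrix A ({..<n} - {i}) ({..<n} - {j})) = dim_row (mat_delete A i j)"
    "dim_col (submatrix A ({..<n} - {i}) ({..<n} - {j})) = dim_col (mat_delete A i j)"
    using assms by (simp_all only: eq dim_row_mat dim_col_mat mat_delete_dim carrier_matD)
  fix k l assume "k < dim_row (mat_delete A i j)" "l < dim_col (mat_delete A i j)"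
  hence kl: "k < n - 1" "l < n - 1" using assms by auto
  show "submatrix A ({..<n} - {i}) ({..<n} - {j}) $$ (k,l) = mat_delete A i j $$ (k,l)"
    unfolding eq using kl assms
    by (simp add: mat_delete_def pick_complement_singleton del: pick.simps)
qed

text \<open>Up to the checkerboard sign, an entry of the adjugate is a minor of order
  \<open>n - 1\<close>.\<close>

lemma totally_positive_cofactor:
  assumes A: "A \<in> carrier_mat n n" and tp: "totally_positive A" and ij: "i < n" "j < n"
  shows "(- 1) ^ (i + j) * adj_mat A $$ (i,j) > 0"
proof -
  have "det (mat_delete A j i) > 0"
  proof (cases "n = 1")
    \<comment> \<open>The deleted matrix is empty and has determinant 1, a case outside
      \<open>totally_positive\<close>, which speaks of nonempty index sets.\<close>
    case True
    thus ?thesis using mat_delete_carrier[OF A, of j i] by simp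
  next
    case False
    hence n: "n \<ge> 2" using ij by simp
    have card: "card ({..<n} - {k}) = n - 1" if "k < n" for k using that by simp
    have "{..<n} - {j} \<noteq> {}"
    proof
      assume "{..<n} - {j} = {}"
      with card[OF ij(2)] n show False by simp
    qed
    with card have "det (submatrix A ({..<n} - {j}) ({..<n} - {i})) > 0"
      using tp A ij unfolding totally_positive_def by auto
    thus ?thesis using submatrix_complement_singleton[OF A ij(2,1)] by simp
  qed
  moreover have "(- 1) ^ (i + j) * adj_mat A $$ (i,j)
      = ((- 1) ^ (i + j) * (- 1) ^ (i + j)) * det (mat_delete A j i)"
    using A ij by (simp add: adj_mat_def cofactor_def add.commute[of j])
  moreover have "(- 1 :: real) ^ (i + j) * (- 1) ^ (i + j) = 1"
    by (simp flip: power_mult_distrib)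
  ultimately show ?thesis by simp
qed

lemma totally_positive_entry:
  assumes tp: "totally_positive A" and ij: "i < dim_row A" "j < dim_col A"
  shows "A $$ (i,j) > 0"
proof -
  have "pick {l} 0 = l" for l by (simp add: Least_equality)
  hence "submatrix A {i} {j} = mat 1 1 (\<lambda>_. A $$ (i,j))"
    using ij by (subst submatrix_eq_mat) (auto intro!: eq_matI simp del: pick.simps)
  moreover have "det (submatrix A {i} {j}) > 0"
    using tp ij unfolding totally_positive_def by auto
  ultimately show ?thesis by (simp add: det_single)
qed

lemma det_2:
  assumes A: "(A :: 'a :: comm_ring_1 mat) \<in> carrier_mat 2 2"
  shows "det A = A $$ (0,0) * A $$ (1,1) - A $$ (0,1) * A $$ (1,0)"
proof -
  have "det A = (\<Sum>j<2. A $$ (0,j) * cofactor A 0 j)"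
    by (rule laplace_expansion_row[OF A]) simp
  also have "{..<2::nat} = {0,1}" by auto
  finally show ?thesis using A by (simp add: cofactor_def det_single mat_delete_def)
qed

lemma totally_positive_minor2:
  assumes tp: "totally_positive A" and ij: "i < i'" "i' < dim_row A" "j < j'" "j' < dim_col A"
  shows "A $$ (i,j') * A $$ (i',j) < A $$ (i,j) * A $$ (i',j')"
proof -
  have p: "pick {l,l'} 0 = l \<and> pick {l,l'} (Suc 0) = l'" if "l < l'" for l l'
  proof -
    have "pick {l,l'} 0 = l" using that by (auto intro!: Least_equality)
    thus ?thesis using that by (auto intro!: Least_equality)
  qed
  define M where "M = submatrix A {i,i'} {j,j'}"
  have Meq: "M = mat 2 2 (\<lambda>(k,l). A $$ (pick {i,i'} k, pick {j,j'} l))"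
    using ij by (simp add: M_def submatrix_eq_mat numeral_2_eq_2 del: pick.simps)
  have M: "M \<in> carrier_mat 2 2" "M $$ (0,0) = A $$ (i,j)" "M $$ (0,1) = A $$ (i,j')"
    "M $$ (1,0) = A $$ (i',j)" "M $$ (1,1) = A $$ (i',j')"
    using p[OF ij(1)] p[OF ij(3)] by (simp_all add: Meq del: pick.simps)
  have "0 < det M"
    using tp ij unfolding totally_positive_def M_def by auto
  also have "det M = M $$ (0,0) * M $$ (1,1) - M $$ (0,1) * M $$ (1,0)"
    by (rule det_2[OF M(1)])
  finally show ?thesis using M by simp
qed

lemma totally_positive_det:
  assumes A: "A \<in> carrier_mat n n" and tp: "totally_positive A" and n: "n > 0"
  shows "det A > 0"
proof -
  have "pick {..<n} k = k" if "k < n" for k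
  proof -
    have "{a \<in> {..<n}. a < k} = {..<k}" using that by auto
    thus ?thesis using pick_card_in_set[of k "{..<n}"] that by simp
  qed
  hence "submatrix A {..<n} {..<n} = A"
    using A by (subst submatrix_eq_mat) (auto intro!: eq_matI)
  moreover have "det (submatrix A {..<n} {..<n}) > 0"
    using tp A n unfolding totally_positive_def by auto
  ultimately show ?thesis by simp
qed

lemma det_3:
  assumes A: "(A :: 'a :: comm_ring_1 mat) \<in> carrier_mat 3 3"
  shows "det A = A $$ (0,0) * (A $$ (1,1) * A $$ (2,2) - A $$ (1,2) * A $$ (2,1))
    - A $$ (0,1) * (A $$ (1,0) * A $$ (2,2) - A $$ (1,2) * A $$ (2,0))
    + A $$ (0,2) * (A $$ (1,0) * A $$ (2,1) - A $$ (1,1) * A $$ (2,0))"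
proof -
  have "det A = (\<Sum>j<3. A $$ (0,j) * cofactor A 0 j)"
    by (rule laplace_expansion_row[OF A]) simp
  also have "{..<3::nat} = {0,1,2}" by auto
  finally show ?thesis using A
    by (simp add: cofactor_def det_2 mat_delete_def numeral_2_eq_2 algebra_simps)
qed

section \<open>The star on four vertices\<close>

text \<open>The centre has index 0 and the leaves are 1, 2, 3, so the lists \<open>[a,0,b]\<close>
  are the paths between distinct leaves. The claim is that the adjugate is positive between leaves
  and at the centre, and negative between centre and leaf.\<close>

lemma star_adj_mat_signs:
  fixes M :: "real mat"
  assumes M: "M \<in> carrier_mat 4 4"
    and tp: "\<And>a b. a \<in> {1,2,3} \<Longrightarrow> b \<in> {1,2,3} \<Longrightarrow> a \<noteq> b \<Longrightarrow>
      totally_positive (principal_submatrix_list M [a,0,b])"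
    and s: "s 0 = 1" "\<And>a. a \<in> {1,2,3} \<Longrightarrow> s a = - 1"
    and ij: "i < 4" "j < 4"
  shows "s i * s j * adj_mat M $$ (i,j) > (0::real)"
proof -
  define m where "m a b = M $$ (a,b)" for a b
  define X where "X a b = adj_mat M $$ (a,b)" for a b
  \<comment> \<open>\<open>m 0 0\<close> times the Schur complement of the centre, which keeps all
    identities free of division.\<close>
  define B where "B a b = m 0 0 * m a b - m a 0 * m 0 b" for a b
  \<comment> \<open>Any two vertices of the star lie on a path between two leaves, so every entry
    occurs in one of the totally positive matrices.\<close>
  have mpos: "m a b > 0" if ab: "a < 4" "b < 4" for a b
  proof -
    have N: "0 < m (p ! k) (p ! l)"
      if "p = [a',0,b']" "a' \<in> {1,2,3}" "b' \<in> {1,2,3}" "a' \<noteq> b'" "k < 3" "l < 3" for p a' b' k l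
      using totally_positive_entry[OF tp, of a' b' k l] that by (simp add: m_def)
    have row: "m a' 0 > 0 \<and> m 0 a' > 0 \<and> m a' a' > 0 \<and> m 0 0 > 0 \<and> m a' b' > 0"
      if "a' \<in> {1,2,3}" "b' \<in> {1,2,3}" "a' \<noteq> b'" for a' b'
      using N[OF refl that, of 0 1] N[OF refl that, of 1 0] N[OF refl that, of 0 0]
        N[OF refl that, of 1 1] N[OF refl that, of 0 2] by simp
    have "a \<in> {0,1,2,3}" "b \<in> {0,1,2,3}" using ab by auto
    thus ?thesis using row[of 1 2] row[of 1 3] row[of 2 1] row[of 2 3] row[of 3 1] row[of 3 2]
      by auto
  qed
  have B: "B a a > 0" "B a b < 0" "B a a * B b b > B a b * B b a"
    if ab: "a \<in> {1,2,3}" "b \<in> {1,2,3}" "a \<noteq> b" for a b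
  proof -
    let ?N = "principal_submatrix_list M [a,0,b]"
    note N = tp[OF ab]
    \<comment> \<open>The centre is in position 1 of \<open>[a,0,b]\<close>: on rows 0, 1 the minor
      with columns 0, 1 is \<open>B a a\<close>, and the one with columns 1, 2 is
      \<open>- B a b\<close>.\<close>
    show "B a a > 0" using totally_positive_minor2[OF N, of 0 1 0 1]
      by (simp add: B_def m_def mult.commute)
    show "B a b < 0" using totally_positive_minor2[OF N, of 0 1 1 2]
      by (simp add: B_def m_def mult.commute)
    have N3: "?N \<in> carrier_mat 3 3" 
      using principal_submatrix_list_carrier[of M "[a,0,b]"] by (simp add: numeral_3_eq_3)
    \<comment> \<open>By the Schur complement formula, \<open>m 0 0\<close> times the determinant is
      a principal minor of order 2 of \<open>B\<close>.\<close>
    have "0 < m 0 0 * det ?N"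
      using totally_positive_det[OF N3 N] mpos[of 0 0] by simp
    also have "\<dots> = B a a * B b b - B a b * B b a"
      unfolding det_3[OF N3] by (simp add: B_def m_def algebra_simps)
    finally show "B a a * B b b > B a b * B b a" by simp
  qed
  text \<open>Sylvester's identity for the Schur complement \<open>B\<close> of the centre.\<close>
  have XB: "m 0 0 * X a a = B b b * B c c - B b c * B c b"
      "m 0 0 * X a b = B a c * B c b - B a b * B c c"
    if "(a,b,c) \<in> {(1,2,3),(1,3,2),(2,1,3),(2,3,1),(3,1,2),(3,2,1)}" for a b c
    using that M
    by (auto simp: X_def adj_mat_def cofactor_def det_3 mat_delete_def B_def m_def
        numeral_2_eq_2 numeral_3_eq_3 algebra_simps)
  have Xpos: "X a b > 0" if "a \<in> {1,2,3}" "b \<in> {1,2,3}" for a b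
  proof -
    have *: "X a a > 0 \<and> X a b > 0"
      if abc: "(a,b,c) \<in> {(1,2,3),(1,3,2),(2,1,3),(2,3,1),(3,1,2),(3,2,1)}" for a b c :: nat
    proof -
      have mem: "a \<in> {1,2,3}" "b \<in> {1,2,3}" "c \<in> {1,2,3}" "a \<noteq> b" "a \<noteq> c" "b \<noteq> c" "c \<noteq> b"
        using abc by auto
      have "m 0 0 * X a a > 0" using B(3)[of b c] mem XB(1)[OF abc] by simp
      moreover have "B a c * B c b > 0" using B(2)[of a c] B(2)[of c b] mem by (simp add: mult_neg_neg)
      moreover have "B a b * B c c < 0" using B(2)[of a b] B(1)[of c b] mem by (simp add: mult_neg_pos)
      ultimately have "m 0 0 * X a a > 0" "m 0 0 * X a b > 0" using XB(2)[OF abc] by simp_all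
      thus ?thesis using mpos[of 0 0] by (simp add: zero_less_mult_iff)
    qed
    show ?thesis using that *[of 1 2 3] *[of 1 3 2] *[of 2 1 3] *[of 2 3 1] *[of 3 1 2] *[of 3 2 1]
      by auto
  qed
  note adj = adj_mat[OF M]
  have sum4: "(\<Sum>k<4. f k) = f 0 + f 1 + f 2 + f 3" for f :: "nat \<Rightarrow> real"
    by (simp add: eval_nat_numeral)
  have MX: "m a 0 * X 0 b + m a 1 * X 1 b + m a 2 * X 2 b + m a 3 * X 3 b = 0"
    and XM: "X a 0 * m 0 b + X a 1 * m 1 b + X a 2 * m 2 b + X a 3 * m 3 b = 0"
    if "a < 4" "b < 4" "a \<noteq> b" for a b
  proof -
    have "(\<Sum>k<4. m a k * X k b) = (M * adj_mat M) $$ (a,b)"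
      "(\<Sum>k<4. X a k * m k b) = (adj_mat M * M) $$ (a,b)"
      using M adj(1) that by (auto simp: m_def X_def scalar_prod_def lessThan_atLeast0 intro!: sum.cong)
    thus "m a 0 * X 0 b + m a 1 * X 1 b + m a 2 * X 2 b + m a 3 * X 3 b = 0"
      "X a 0 * m 0 b + X a 1 * m 1 b + X a 2 * m 2 b + X a 3 * m 3 b = 0"
      using that unfolding adj sum4 by simp_all
  qed
  have neg: "y < 0" if "x * y + p + q + r = 0" "x > 0" "p > 0" "q > 0" "r > 0" for x y p q r :: real
  proof -
    have "x * y < 0" using that by simp
    thus ?thesis using that(2) by (simp add: mult_less_0_iff)
  qed
  \<comment> \<open>Off the diagonal the products with the adjugate vanish, so the term of the
    centre must cancel three positive terms of leaves.\<close>
  have X0b: "X 0 b < 0" if "b \<in> {1,2,3}" for b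
    by (rule neg[OF MX[of 0 b]]) (use that mpos Xpos in auto)
  have Xa0: "X a 0 < 0" if "a \<in> {1,2,3}" for a
  proof (rule neg)
    show "m 0 0 * X a 0 + X a 1 * m 1 0 + X a 2 * m 2 0 + X a 3 * m 3 0 = 0"
      using XM[of a 0] that by (auto simp: mult.commute)
  qed (use that mpos Xpos in auto)
  \<comment> \<open>The diagonal equation would bring in the determinant, whose sign is unknown. Row
    1 against column 0 gives 0 instead, and negating it makes the three leaf terms positive.\<close>
  have X00: "X 0 0 > 0"
  proof -
    have "- X 0 0 < 0"
    proof (rule neg)
      show "m 1 0 * - X 0 0 + m 1 1 * - X 1 0 + m 1 2 * - X 2 0 + m 1 3 * - X 3 0 = 0"
        using MX[of 1 0] by simp
    qed (use mpos Xa0 in \<open>auto simp: mult_pos_neg\<close>)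
    thus ?thesis by simp
  qed
  have "i \<in> {0,1,2,3}" "j \<in> {0,1,2,3}" using ij by auto
  thus ?thesis unfolding X_def[symmetric] using s(1) s(2)[of 1] s(2)[of 2] s(2)[of 3] X00 X0b Xa0 Xpos
    by auto
qed

section \<open>Paths in small trees\<close>

lemma vpath_with_proj_iff:
  "vpath p (with_proj T) \<longleftrightarrow>
    set p \<subseteq> pverts T \<and> set (vwalk_arcs p) \<subseteq> parcs T \<and> p \<noteq> [] \<and> distinct p"
  by (auto simp: vpath_def vwalk_def)

lemma vpath_slice:
  assumes "vpath (xs @ ys @ zs) (with_proj T)" "ys \<noteq> []"
  shows "vpath ys (with_proj T)"
  using assms set_vwalk_arcs_append1[of ys zs] set_vwalk_arcs_append2[of "ys @ zs" xs]
  by (auto simp: vpath_with_proj_iff)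

text \<open>Passes from paths as vertex lists to walks as arc lists, the language of
  \<open>cycle\<close>; with \<open>u = hd p\<close> the walk is closed.\<close>

lemma close_vwalk:
  assumes "p \<noteq> []"
  shows "pcas (hd p) (vwalk_arcs p @ [(last p, u)]) u"
    and "pawalk_verts (hd p) (vwalk_arcs p @ [(last p, u)]) = p @ [u]"
proof -
  have "pcas (hd p) (vwalk_arcs p @ [(last p, u)]) u \<and>
      pawalk_verts (hd p) (vwalk_arcs p @ [(last p, u)]) = p @ [u]"
    using assms by (induction p rule: vwalk_arcs.induct) auto
  thus "pcas (hd p) (vwalk_arcs p @ [(last p, u)]) u"
    "pawalk_verts (hd p) (vwalk_arcs p @ [(last p, u)]) = p @ [u]" by auto
qed

locale undirected_tree_graph =
  fixes T :: "'a pair_pre_digraph"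
  assumes tree: "undirected_tree T"
begin

sublocale pair_graph T using tree by (simp add: undirected_tree_def)

text \<open>A closing arc would give a cycle with as many arcs as \<open>p\<close> has vertices,
  hence of a length excluded in \<open>undirected_tree\<close>.\<close>

lemma no_closing_arc:
  assumes p: "vpath p (with_proj T)" and len: "length p \<ge> 3"
  shows "(last p, hd p) \<notin> parcs T"
proof
  assume arc: "(last p, hd p) \<in> parcs T"
  let ?q = "vwalk_arcs p @ [(last p, hd p)]"
  have p': "set p \<subseteq> pverts T" "set (vwalk_arcs p) \<subseteq> parcs T" "p \<noteq> []" "distinct p"
    using p by (auto simp: vpath_with_proj_iff)
  \<comment> \<open>A cycle visits distinct vertices after its first one; here these are the
    vertices of \<open>p\<close> with its head moved to the end.\<close>
  have "distinct (tl p @ [hd p])" using p'(3,4) by (cases p) auto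
  hence "pre_digraph.cycle (with_proj T) ?q"
    using p' arc close_vwalk[OF p'(3), of "hd p"]
    by (auto simp: cycle_def awalk_def intro!: exI[of _ "hd p"])
  moreover have "length ?q \<ge> 3"
    using len vwalk_length_simp[of p] unfolding vwalk_length_def by simp
  ultimately show False using tree unfolding undirected_tree_def by blast
qed

text \<open>The segment of \<open>p\<close> from position \<open>i\<close> to position
  \<open>j\<close> is itself a path with at least three vertices, and the arc would close
  it.\<close>

lemma no_chord:
  assumes p: "vpath p (with_proj T)" and ij: "i + 2 \<le> j" "j < length p"
  shows "(p ! j, p ! i) \<notin> parcs T"
proof -
  define q where "q = take (j + 1 - i) (drop i p)"
  have len: "length q = j + 1 - i" using ij by (simp add: q_def)
  hence ne: "q \<noteq> []" using ij by auto
  have "p = take i p @ q @ drop (j + 1 - i) (drop i p)"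
    unfolding q_def by (simp only: append_take_drop_id)
  with p have "vpath q (with_proj T)" using vpath_slice ne by metis
  moreover have "hd q = p ! i" "last q = p ! j"
    using ij len ne by (simp_all add: hd_conv_nth last_conv_nth q_def)
  ultimately show ?thesis using no_closing_arc[of q] len ij by simp
qed

lemma arc_leaving:
  assumes "u \<in> S" "u \<in> pverts T" "v \<in> pverts T" "v \<notin> S"
  obtains x y where "x \<in> S" "y \<notin> S" "(x, y) \<in> parcs T"
proof -
  \<comment> \<open>Connectedness is strong connectedness of the symmetric closure; as
    \<open>T\<close> is symmetric, this is reachability in \<open>T\<close> itself.\<close>
  have "Digraph_Component.strongly_connected (with_proj (mk_symmetric (with_proj T)))"
    using tree by (simp add: undirected_tree_def Digraph_Component.connected_def)
  hence "reachable (with_proj (mk_symmetric (with_proj T))) u v"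
    using assms by (simp add: Digraph_Component.strongly_connected_def)
  hence uv: "reachable (with_proj T) u v" using reachable_mk_symmetric_eq[OF sym_arcs] by simp
  have "v \<in> S" if closed: "\<And>x y. x \<in> S \<Longrightarrow> (x, y) \<in> parcs T \<Longrightarrow> y \<in> S"
    using uv by (induction rule: reachable_induct) (use assms(1) closed in auto)
  thus thesis using assms(4) that by blast
qed

text \<open>If a longest path misses a vertex, some arc leaves it, and not at an end, where it would
  extend the path. The path has at most three vertices, so the arc starts at the middle one, and the
  four vertices now found are all.\<close>

lemma hamiltonian_path_or_star:
  assumes card: "card (pverts T) < 5"
  obtains (path) p where "vpath p (with_proj T)" "set p = pverts T"
  | (star) c i j k where "distinct [c,i,j,k]" "pverts T = {c,i,j,k}"
      "(c,i) \<in> parcs T" "(c,j) \<in> parcs T" "(c,k) \<in> parcs T"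
proof -
  obtain v where v: "v \<in> pverts T"
    using tree by (auto simp: undirected_tree_def Digraph_Component.connected_def
        Digraph_Component.strongly_connected_def)
  have single: "vpath [v] (with_proj T)" using v by (simp add: vpath_with_proj_iff)
  have bound: "length q \<le> card (pverts T)" if "vpath q (with_proj T)" for q
    using that card_mono[of "pverts T" "set q"] distinct_card[of q] pair_finite_verts
    by (auto simp: vpath_with_proj_iff)
  have "\<exists>p. vpath p (with_proj T) \<and> (\<forall>q. vpath q (with_proj T) \<longrightarrow> length q \<le> length p)"
    using bound
    by (intro ex_has_greatest_nat[where P = "\<lambda>q. vpath q (with_proj T)" and f = length
          and b = "Suc (card (pverts T))", OF single]) (simp add: less_Suc_eq_le)
  then obtain p where p: "vpath p (with_proj T)"
    and longest: "\<And>q. vpath q (with_proj T) \<Longrightarrow> length q \<le> length p" by blast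
  have p': "set p \<subseteq> pverts T" "set (vwalk_arcs p) \<subseteq> parcs T" "p \<noteq> []" "distinct p"
    using p by (auto simp: vpath_with_proj_iff)
  show thesis
  proof (cases "set p = pverts T")
    case True
    with p show ?thesis by (rule path)
  next
    case False
    then obtain w where w: "w \<in> pverts T" "w \<notin> set p" using p'(1) by blast
    have hd: "hd p \<in> set p" using p'(3) by simp
    obtain x y where xy: "x \<in> set p" "y \<notin> set p" "(x, y) \<in> parcs T"
      using arc_leaving[OF hd _ w] p'(1) hd by blast
    have yx: "(y, x) \<in> parcs T" using arcs_symmetric[OF xy(3)] .
    have y: "y \<in> pverts T" using in_arcsD2[OF xy(3)] .
    have "x \<noteq> hd p"
    proof
      assume "x = hd p"
      hence "vpath (y # p) (with_proj T)" using p' xy yx y by (auto simp: vpath_with_proj_iff)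
      from longest[OF this] show False by simp
    qed
    moreover have "x \<noteq> last p"
    proof
      assume "x = last p"
      hence "vpath (p @ [y]) (with_proj T)"
        using p' xy y by (auto simp: vpath_with_proj_iff vwalk_arcs_append)
      from longest[OF this] show False by simp
    qed
    moreover have "length p < 4"
    proof -
      have "card (insert y (set p)) \<le> card (pverts T)"
        using p'(1) y pair_finite_verts by (intro card_mono) auto
      thus ?thesis using xy(2) p'(4) card by (simp add: distinct_card)
    qed
    ultimately obtain a b where ab: "p = [a,x,b]"
    proof -
      assume *: "x \<noteq> hd p" "x \<noteq> last p" "length p < 4" and **: "\<And>a b. p = [a,x,b] \<Longrightarrow> thesis"
      from *(3) consider "p = []" | a where "p = [a]" | a b where "p = [a,b]" | a b c where "p = [a,b,c]"
        by (cases p; cases "tl p"; cases "tl (tl p)"; cases "tl (tl (tl p))") auto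
      thus thesis by cases (use * ** xy(1) in auto)
    qed
    have "distinct [x,a,b,y]" using p'(4) xy(2) by (auto simp: ab)
    moreover have "pverts T = {x,a,b,y}"
    proof (rule card_seteq[symmetric])
      show "{x,a,b,y} \<subseteq> pverts T" using p'(1) y by (auto simp: ab)
      show "card (pverts T) \<le> card {x,a,b,y}" using \<open>distinct [x,a,b,y]\<close> card by simp
    qed (rule pair_finite_verts)
    moreover have "(x,a) \<in> parcs T" "(x,b) \<in> parcs T"
      using p'(2) arcs_symmetric by (auto simp: ab)
    ultimately show ?thesis using xy(3) by (rule star)
  qed
qed

end

text \<open>The equivalence in the conclusion says that exactly one complex eigenvalue attains the
  minimum modulus and that it is real.\<close>

theorem theorem2p1:
  fixes n :: nat and T :: "nat pair_pre_digraph" and A :: "real mat"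
  assumes "n < 5"
    and "undirected_tree T" and "pverts T = {..<n}"
    and "A \<in> carrier_mat n n"
    and "T_TP T A"
  shows "\<exists>r::real.
           (\<forall>\<mu>. min_modulus_eigenvalue A \<mu> \<longleftrightarrow> \<mu> = complex_of_real r) \<and>
           (\<exists>v. eigenvector A v r \<and> (\<forall>i<n. v $ i \<noteq> 0) \<and> signed_according_to T v)"
proof -
  interpret undirected_tree_graph T by unfold_locales fact
  note A = \<open>A \<in> carrier_mat n n\<close> and verts = \<open>pverts T = {..<n}\<close>
  have tp: "totally_positive (principal_submatrix_list A q)" if "vpath q (with_proj T)" for q
    using \<open>T_TP T A\<close> that by (simp add: T_TP_def)
  \<comment> \<open>The common end of both cases: an ordering \<open>p\<close> of the vertices and
    signs, indexed by positions in \<open>p\<close>, that fit the adjugate and are opposite along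
    every arc.\<close>
  have *: ?thesis
    if p: "distinct p" "set p = {..<n}" and n: "n > 0" and s: "\<And>i. i < n \<Longrightarrow> \<bar>s i\<bar> = 1"
      and pos: "\<And>i j. i < n \<Longrightarrow> j < n \<Longrightarrow>
        s i * s j * adj_mat (principal_submatrix_list A p) $$ (i,j) > 0"
      and alt: "\<And>i j. i < n \<Longrightarrow> j < n \<Longrightarrow> (p ! i, p ! j) \<in> parcs T \<Longrightarrow> s i * s j = - 1"
    for p and s :: "nat \<Rightarrow> real"
  proof -
    obtain r v where rv: "\<And>\<mu>. min_modulus_eigenvalue A \<mu> \<longleftrightarrow> \<mu> = complex_of_real r"
      "eigenvector A v r" "\<And>i. i < n \<Longrightarrow> s i * v $ (p ! i) > 0"
      using min_modulus_eigenvalue_of_signed_adj_mat[OF A n p s pos] by blast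
    have idx: "\<exists>a<n. x = p ! a" if "x < n" for x
    proof -
      have "length p = n" "x \<in> set p" using that p distinct_card[OF p(1)] by simp_all
      thus ?thesis by (metis in_set_conv_nth)
    qed
    have "v $ x \<noteq> 0" if "x < n" for x using idx[OF that] rv(3) by force
    moreover have "v $ x * v $ y < 0" if xy: "(x,y) \<in> parcs T" for x y
    proof -
      have "x < n" "y < n" using in_arcsD1[OF xy] in_arcsD2[OF xy] verts by auto
      from idx[OF this(1)] idx[OF this(2)] obtain a b
        where ab: "a < n" "b < n" "x = p ! a" "y = p ! b" by auto
      have "0 < (s a * v $ x) * (s b * v $ y)"
        using rv(3)[OF ab(1)] rv(3)[OF ab(2)] unfolding ab(3,4) by (rule mult_pos_pos)
      also have "\<dots> = s a * s b * (v $ x * v $ y)" by (simp add: mult_ac)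
      finally show ?thesis using alt[of a b] ab xy by simp
    qed
    ultimately show ?thesis using rv(1,2) unfolding signed_according_to_def by blast
  qed
  have "card (pverts T) < 5" using \<open>n < 5\<close> verts by simp
  thus ?thesis
  proof (cases rule: hamiltonian_path_or_star)
    case (path p)
    have p: "distinct p" "set p = {..<n}" "p \<noteq> []"
      using path verts by (simp_all add: vpath_with_proj_iff)
    have len: "length p = n" using distinct_card[OF p(1)] p(2) by simp
    show ?thesis
    proof (rule *[OF p(1,2), of "\<lambda>i. (- 1) ^ i"])
      show "n > 0" using len p(3) by auto
      have carr: "principal_submatrix_list A p \<in> carrier_mat n n"
        using principal_submatrix_list_carrier[of A p] len by simp
      fix i j assume ij: "i < n" "j < n"
      show "(- 1) ^ i * (- 1) ^ j * adj_mat (principal_submatrix_list A p) $$ (i,j) > 0"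
        using totally_positive_cofactor[OF carr tp[OF path(1)] ij] by (simp add: power_add)
      assume arc: "(p ! i, p ! j) \<in> parcs T"
      \<comment> \<open>Without chords or loops, an arc joins consecutive positions of the path,
        where the signs differ.\<close>
      have "\<not> i + 2 \<le> j" "\<not> j + 2 \<le> i" "i \<noteq> j"
        using no_chord[OF path(1), of i j] no_chord[OF path(1), of j i] ij len arc
          arcs_symmetric[OF arc] no_loops'[OF arc] by auto
      hence "j = Suc i \<or> i = Suc j" by arith
      thus "(- 1) ^ i * (- 1) ^ j = (- 1 :: real)" by (auto simp flip: power_mult_distrib)
    qed simp
  next
    case (star c i j k)
    let ?p = "[c,i,j,k]"
    have sp: "set ?p = {..<n}" using star(2) verts by simp
    have n: "n = 4" using distinct_card[OF star(1)] unfolding sp by simp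
    define M where "M = principal_submatrix_list A ?p"
    define s :: "nat \<Rightarrow> real" where "s i = (if i = 0 then 1 else - 1)" for i
    have path: "vpath [?p ! a, c, ?p ! b] (with_proj T)"
      if "a \<in> {1,2,3}" "b \<in> {1,2,3}" "a \<noteq> b" for a b
      using that star arcs_symmetric by (auto simp: vpath_with_proj_iff)
    show ?thesis
    proof (rule *[OF star(1) sp, of s])
      show "n > 0" by (simp add: n)
      show "\<bar>s i\<bar> = 1" for i by (simp add: s_def)
      fix a b assume ab: "a < n" "b < n"
      have "s a * s b * adj_mat M $$ (a,b) > 0"
      proof (rule star_adj_mat_signs)
        show "M \<in> carrier_mat 4 4"
          using principal_submatrix_list_carrier[of A ?p] by (simp add: M_def eval_nat_numeral)
        fix a b :: nat assume ab: "a \<in> {1,2,3}" "b \<in> {1,2,3}" "a \<noteq> b"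
        have "principal_submatrix_list M [a,0,b] = principal_submatrix_list A [?p ! a, c, ?p ! b]"
          using ab by (intro eq_matI) (auto simp: M_def nth_Cons' less_Suc_eq)
        thus "totally_positive (principal_submatrix_list M [a,0,b])"
          using tp[OF path[OF ab]] by simp
      qed (use ab n in \<open>auto simp: s_def\<close>)
      thus "s a * s b * adj_mat (principal_submatrix_list A ?p) $$ (a,b) > 0" by (simp add: M_def)
      assume arc: "(?p ! a, ?p ! b) \<in> parcs T"
      have "a \<noteq> b" using no_loops'[OF arc] by auto
      \<comment> \<open>An arc between two leaves would close the path through the centre to a
        triangle.\<close>
      moreover have "a = 0 \<or> b = 0"
      proof (rule ccontr)
        assume "\<not> (a = 0 \<or> b = 0)"
        hence "a \<in> {1,2,3}" "b \<in> {1,2,3}" using ab n by auto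
        from no_closing_arc[OF path[OF this \<open>a \<noteq> b\<close>]] arcs_symmetric[OF arc] show False by simp
      qed
      ultimately show "s a * s b = - 1" by (auto simp: s_def)
    qed
  qed
qed

end
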